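(* Let $1\le r\le n$, and consider, for $i=1,\dots,r$, the equations $$\prod_{j\ne i}\Big(1-\hbar\lambda\frac{P_i}{P_j}\Big)\prod_{j\ne i}\Big(1-\lambda\frac{P_j}{P_i}\Big)\prod_{a=1}^n\Big(1-\frac{P_i}{t_a}\Big)-Q_i\prod_{j\ne i}\Big(1-\hbar\lambda\frac{P_j}{P_i}\Big)\prod_{a=1}^n\Big(1-\hbar\frac{P_i}{t_a}\Big)\prod_{j\ne i}\Big(1-\lambda\frac{P_i}{P_j}\Big)=0,$$ where $j$ ranges over $\{1,\dots,r\}\setminus\{i\}$. Under the abelian/non-abelian map $\phi$ (which sends $\lambda\mapsto1$, $Q_i\mapsto Q$ for all $i$, and $\hbar\mapsto\hbar$) and after the change of variables $P_i\mapsto x_i$, these equations map to the Bethe-Ansatz equations of $T^*G(r,n)$, $$\prod_{a=1}^n\frac{x_i/t_a-1}{\hbar x_i/t_a-1}+(-1)^rQ\prod_{\substack{j=1\\ j\ne i}}^r\frac{\hbar x_j-x_i}{\hbar x_i-x_j}=0,\qquad i=1,\dots,r,$$ i.e. the two systems coincide as equations between rational functions in $x_1,\dots,x_r,t_1,\dots,t_n,\hbar,Q$ (after multiplying or dividing by the nonzero factors occurring as denominators).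
   Context: The Grassmannian $G(r,n)=\mathrm{Hom}(\mathbb{C}^r,\mathbb{C}^n)//GL_r$ has abelianization $(\mathbb{P}^{n-1})^r$; $P_i$ denotes the tautological bundle $\mathcal O(-1)$ of the $i$-th factor, $Q_i$ its quantum parameter, and $\lambda$ an auxiliary equivariant parameter of a twisted quantum $K$-theory of $(\mathbb{P}^{n-1})^r$. The abelian/non-abelian map $\phi$ goes from (Weyl-invariants of) this twisted quantum $K$-theory to the quantum $K$-theory of $G(r,n)$; for the present statement only its effect on parameters matters: $Q_1,\dots,Q_r\mapsto Q$, $\lambda\mapsto1$, and it is extended by $\hbar\mapsto\hbar$. The parameters $t_1,\dots,t_n$ are equivariant parameters of $T=(\mathbb{C}^* )^n$. The general form of the Bethe-Ansatz equations is $\prod_{j=1}^n\frac{x_i/t_j-1}{kx_i/t_j-s}+(-1)^rQ\prod_{j\ne i}\frac{kx_j-sx_i}{kx_i-sx_j}=0$, with $k=-y$, $s=1$, $y=-\hbar$ (so $k=\hbar$). *)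

theory Defs
  imports
    Complex_Main
    "HOL-Library.Countable"
    "HOL-Library.Poly_Mapping"
    "HOL-Computational_Algebra.Fraction_Field"
begin

section \<open>The field of rational functions in the parameters\<close>

text \<open>
  All parameters live in one rational function field over the complex numbers. The parameters
  \<open>P\<^sub>i, x\<^sub>i, Q\<^sub>i, t\<^sub>a\<close> are indexed by arbitrary natural numbers; only \<open>1 \<le> i \<le> r\<close> and
  \<open>1 \<le> a \<le> n\<close> are used. \<open>Var_Q\<close> is the single quantum parameter \<open>Q\<close> of \<open>G(r,n)\<close>,
  as opposed to the parameters \<open>Q\<^sub>i\<close> of the factors of \<open>(\<bbbP>\<^sup>n\<^sup>-\<^sup>1)\<^sup>r\<close>.
\<close>

datatype param =
    Var_P nat | Var_x nat | Var_Qi nat | Var_Q | Var_t nat | Var_lambda | Var_hbar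

text \<open>
  The order on parameters is arbitrary; it is needed only because the library proves
  that polynomial rings are integral domains for linearly ordered sets of variables.
\<close>

instance param :: countable
  by countable_datatype

instantiation param :: linorder
begin

definition less_eq_param :: "param \<Rightarrow> param \<Rightarrow> bool"
  where "less_eq_param u v \<longleftrightarrow> to_nat u \<le> to_nat v"

definition less_param :: "param \<Rightarrow> param \<Rightarrow> bool"
  where "less_param u v \<longleftrightarrow> to_nat u < to_nat v"

instance
  by standard (auto simp: less_eq_param_def less_param_def)

end

type_synonym param_poly = "(param \<Rightarrow>\<^sub>0 nat) \<Rightarrow>\<^sub>0 complex"
type_synonym ratfun = "param_poly fract"

definition rf_const :: "complex \<Rightarrow> ratfun"
  where "rf_const c = Fract (Poly_Mapping.single 0 c) 1"

definition rf_var :: "param \<Rightarrow> ratfun"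
  where "rf_var v = Fract (Poly_Mapping.single (Poly_Mapping.single v 1) 1) 1"


section \<open>Substitution of rational functions for the parameters\<close>

definition monom_subst :: "(param \<Rightarrow> ratfun) \<Rightarrow> (param \<Rightarrow>\<^sub>0 nat) \<Rightarrow> ratfun"
  where "monom_subst \<sigma> m =
    (\<Prod>v\<in>Poly_Mapping.keys m. \<sigma> v ^ Poly_Mapping.lookup m v)"

definition poly_subst :: "(param \<Rightarrow> ratfun) \<Rightarrow> param_poly \<Rightarrow> ratfun"
  where "poly_subst \<sigma> p =
    (\<Sum>m\<in>Poly_Mapping.keys p. rf_const (Poly_Mapping.lookup p m) * monom_subst \<sigma> m)"

text \<open>
  A substitution is defined on those rational functions that have a representation whose
  denominator does not vanish under the substitution; the value does not depend on
  the representation (\<open>rf_subst_Fract\<close> below). Elsewhere \<open>rf_subst\<close> is unspecified.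
  The condition \<open>poly_subst \<sigma> b \<noteq> 0\<close> entails \<open>b \<noteq> 0\<close>.
\<close>

definition rf_subst :: "(param \<Rightarrow> ratfun) \<Rightarrow> ratfun \<Rightarrow> ratfun"
  where "rf_subst \<sigma> f =
    (THE y. \<exists>a b. f = Fract a b \<and> poly_subst \<sigma> b \<noteq> 0 \<and> y = poly_subst \<sigma> a / poly_subst \<sigma> b)"

lemma rf_const_0 [simp]: "rf_const 0 = 0"
  by (simp add: rf_const_def Zero_fract_def)

lemma rf_const_1 [simp]: "rf_const 1 = 1"
  by (simp add: rf_const_def One_fract_def)

lemma rf_const_add: "rf_const (c + d) = rf_const c + rf_const d"
  by (simp add: rf_const_def single_add)

lemma rf_const_mult: "rf_const (c * d) = rf_const c * rf_const d"
  by (simp add: rf_const_def mult_single)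

lemma monom_subst_superset:
  assumes "finite V" and "Poly_Mapping.keys m \<subseteq> V"
  shows "monom_subst \<sigma> m = (\<Prod>v\<in>V. \<sigma> v ^ Poly_Mapping.lookup m v)"
  unfolding monom_subst_def
  by (rule prod.mono_neutral_left) (use assms in \<open>auto simp: in_keys_iff\<close>)

lemma monom_subst_0 [simp]: "monom_subst \<sigma> 0 = 1"
  by (simp add: monom_subst_def)

lemma monom_subst_add: "monom_subst \<sigma> (m + m') = monom_subst \<sigma> m * monom_subst \<sigma> m'"
proof -
  let ?V = "Poly_Mapping.keys m \<union> Poly_Mapping.keys m'"
  have "monom_subst \<sigma> (m + m') = (\<Prod>v\<in>?V. \<sigma> v ^ Poly_Mapping.lookup (m + m') v)"
    by (rule monom_subst_superset) (auto dest: subsetD[OF keys_add])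
  also have "\<dots> = (\<Prod>v\<in>?V. \<sigma> v ^ Poly_Mapping.lookup m v) * (\<Prod>v\<in>?V. \<sigma> v ^ Poly_Mapping.lookup m' v)"
    by (simp add: lookup_add power_add prod.distrib)
  also have "\<dots> = monom_subst \<sigma> m * monom_subst \<sigma> m'"
    by (simp add: monom_subst_superset[of ?V])
  finally show ?thesis .
qed

lemma poly_subst_0 [simp]: "poly_subst \<sigma> 0 = 0"
  by (simp add: poly_subst_def)

lemma poly_subst_single [simp]:
  "poly_subst \<sigma> (Poly_Mapping.single m c) = rf_const c * monom_subst \<sigma> m"
  by (simp add: poly_subst_def)

lemma poly_subst_1 [simp]: "poly_subst \<sigma> 1 = 1"
  using poly_subst_single[of \<sigma> 0 1] by simp

lemma poly_subst_add: "poly_subst \<sigma> (p + q) = poly_subst \<sigma> p + poly_subst \<sigma> q"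
  unfolding poly_subst_def
  by (rule setsum_keys_plus_distrib) (simp_all add: rf_const_add algebra_simps)

lemma poly_subst_uminus: "poly_subst \<sigma> (- p) = - poly_subst \<sigma> p"
  using poly_subst_add[of \<sigma> p "- p"] by (simp add: eq_neg_iff_add_eq_0 add.commute)

lemma poly_subst_diff: "poly_subst \<sigma> (p - q) = poly_subst \<sigma> p - poly_subst \<sigma> q"
  using poly_subst_add[of \<sigma> p "- q"] by (simp add: poly_subst_uminus)

lemma poly_induct_single [case_names zero single add]:
  fixes p :: param_poly
  assumes zero: "R 0"
    and single: "\<And>m c. R (Poly_Mapping.single m c)"
    and add: "\<And>p q. R p \<Longrightarrow> R q \<Longrightarrow> R (p + q)"
  shows "R p"
proof (induction p rule: update_induct)
  case const
  show ?case by (rule zero)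
next
  case (update p m c)
  have "Poly_Mapping.update m c p = p + Poly_Mapping.single m c"
    using update.hyps
    by (intro poly_mapping_eqI)
      (auto simp: lookup_update lookup_add lookup_single in_keys_iff when_def)
  then show ?case
    using add[OF update.IH single] by simp
qed

lemma poly_subst_mult: "poly_subst \<sigma> (p * q) = poly_subst \<sigma> p * poly_subst \<sigma> q"
proof (induction p rule: poly_induct_single)
  case (single m c)
  show ?case
  proof (induction q rule: poly_induct_single)
    case (single m' c')
    show ?case by (simp add: mult_single rf_const_mult monom_subst_add)
  qed (simp_all add: distrib_left poly_subst_add del: poly_subst_single)
qed (simp_all add: distrib_right poly_subst_add)

lemma rf_subst_Fract:
  assumes "poly_subst \<sigma> b \<noteq> 0"
  shows "rf_subst \<sigma> (Fract a b) = poly_subst \<sigma> a / poly_subst \<sigma> b"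
  unfolding rf_subst_def
proof (rule the_equality)
  show "\<exists>a' b'. Fract a b = Fract a' b' \<and> poly_subst \<sigma> b' \<noteq> 0 \<and>
      poly_subst \<sigma> a / poly_subst \<sigma> b = poly_subst \<sigma> a' / poly_subst \<sigma> b'"
    using assms by blast
next
  fix y
  assume "\<exists>a' b'. Fract a b = Fract a' b' \<and> poly_subst \<sigma> b' \<noteq> 0 \<and>
      y = poly_subst \<sigma> a' / poly_subst \<sigma> b'"
  then obtain a' b' where eq: "Fract a b = Fract a' b'" and nz: "poly_subst \<sigma> b' \<noteq> 0"
    and y: "y = poly_subst \<sigma> a' / poly_subst \<sigma> b'" by blast
  have "b \<noteq> 0" "b' \<noteq> 0" using assms nz by auto
  with eq have "a * b' = a' * b" by (simp add: eq_fract)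
  then have "poly_subst \<sigma> a * poly_subst \<sigma> b' = poly_subst \<sigma> a' * poly_subst \<sigma> b"
    by (metis poly_subst_mult)
  then show "y = poly_subst \<sigma> a / poly_subst \<sigma> b"
    using assms nz y by (simp add: frac_eq_eq)
qed

lemma rf_subst_var [simp]: "rf_subst \<sigma> (rf_var v) = \<sigma> v"
  by (simp add: rf_var_def rf_subst_Fract monom_subst_def)


section \<open>The abelian/non-abelian map on parameters and the change of variables\<close>

fun phi_param :: "param \<Rightarrow> ratfun"
  where
    "phi_param Var_lambda = 1"
  | "phi_param (Var_Qi i) = rf_var Var_Q"
  | "phi_param v = rf_var v"

definition phi :: "ratfun \<Rightarrow> ratfun"
  where "phi = rf_subst phi_param"

fun change_vars_param :: "param \<Rightarrow> ratfun"
  where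
    "change_vars_param (Var_P i) = rf_var (Var_x i)"
  | "change_vars_param v = rf_var v"

definition change_vars :: "ratfun \<Rightarrow> ratfun"
  where "change_vars = rf_subst change_vars_param"


section \<open>The two systems of equations\<close>

text \<open>
  Left-hand sides of the \<open>i\<close>-th equations, over an arbitrary field: they are used both in the
  rational function field and for values of the parameters in other fields.
\<close>

definition abelian_lhs ::
  "nat \<Rightarrow> nat \<Rightarrow> (nat \<Rightarrow> 'a) \<Rightarrow> (nat \<Rightarrow> 'a) \<Rightarrow> (nat \<Rightarrow> 'a) \<Rightarrow> 'a \<Rightarrow> 'a \<Rightarrow> nat \<Rightarrow> 'a::field"
  where "abelian_lhs r n P Qi t lam hbar i =
      (\<Prod>j\<in>{1..r} - {i}. 1 - hbar * lam * (P i / P j))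
        * (\<Prod>j\<in>{1..r} - {i}. 1 - lam * (P j / P i))
        * (\<Prod>a=1..n. 1 - P i / t a)
    - Qi i
        * (\<Prod>j\<in>{1..r} - {i}. 1 - hbar * lam * (P j / P i))
        * (\<Prod>a=1..n. 1 - hbar * (P i / t a))
        * (\<Prod>j\<in>{1..r} - {i}. 1 - lam * (P i / P j))"

definition bethe_lhs ::
  "nat \<Rightarrow> nat \<Rightarrow> (nat \<Rightarrow> 'a) \<Rightarrow> 'a \<Rightarrow> (nat \<Rightarrow> 'a) \<Rightarrow> 'a \<Rightarrow> nat \<Rightarrow> 'a::field"
  where "bethe_lhs r n x Q t hbar i =
      (\<Prod>a=1..n. (x i / t a - 1) / (hbar * (x i / t a) - 1))
    + (-1) ^ r * Q * (\<Prod>j\<in>{1..r} - {i}. (hbar * x j - x i) / (hbar * x i - x j))"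

text \<open>
  The factor relating the two left-hand sides. The abelian equation arises from the
  Bethe-Ansatz equation by multiplying with the denominators \<open>\<hbar> x\<^sub>i / t\<^sub>a - 1\<close> and
  \<open>\<hbar> x\<^sub>i - x\<^sub>j\<close>, and with the factors \<open>x\<^sub>i - x\<^sub>j\<close> that are common to both of its terms,
  up to sign and monomials in the \<open>x\<^sub>j\<close>.
\<close>

definition clearing_factor ::
  "nat \<Rightarrow> nat \<Rightarrow> (nat \<Rightarrow> 'a) \<Rightarrow> (nat \<Rightarrow> 'a) \<Rightarrow> 'a \<Rightarrow> nat \<Rightarrow> 'a::field"
  where "clearing_factor r n x t hbar i =
      (\<Prod>j\<in>{1..r} - {i}. 1 - hbar * (x i / x j))
        * (\<Prod>j\<in>{1..r} - {i}. 1 - x j / x i)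
        * (\<Prod>a=1..n. 1 - hbar * (x i / t a))"

end

theory Submission
  imports Defs
begin

text \<open>
  At \<open>\<lambda> = 1\<close> and \<open>Q\<^sub>i = Q\<close> the abelian equation is the Bethe-Ansatz equation with its
  denominators cleared. For each \<open>a\<close>, the factor \<open>1 - \<hbar> x\<^sub>i / t\<^sub>a\<close> turns
  \<open>(x\<^sub>i / t\<^sub>a - 1) / (\<hbar> x\<^sub>i / t\<^sub>a - 1)\<close> into \<open>1 - x\<^sub>i / t\<^sub>a\<close>. For each \<open>j \<noteq> i\<close>,
  \<open>(1 - \<hbar> x\<^sub>i / x\<^sub>j) (1 - x\<^sub>j / x\<^sub>i) (\<hbar> x\<^sub>j - x\<^sub>i) / (\<hbar> x\<^sub>i - x\<^sub>j)
    = - (1 - \<hbar> x\<^sub>j / x\<^sub>i) (1 - x\<^sub>i / x\<^sub>j)\<close>,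
  because the factors \<open>\<hbar> x\<^sub>i - x\<^sub>j\<close> cancel up to sign and \<open>x\<^sub>i - x\<^sub>j\<close> is antisymmetric. There are
  \<open>r - 1\<close> such \<open>j\<close>, so the signs multiply to \<open>(-1)\<^sup>r\<^sup>-\<^sup>1\<close>; together with the sign \<open>(-1)\<^sup>r\<close> of the
  Bethe-Ansatz equation they give the minus sign in front of \<open>Q\<close> in the abelian equation. This is
  \<open>abelian_lhs_eq_clearing_factor_times_bethe_lhs\<close>, an identity valid in every field as long
  as the denominators do not vanish, and it gives the equivalence of the two equations wherever the
  clearing factor is nonzero as well.

  For the rational functions themselves, one has to know that \<open>\<phi>\<close> and the change of variables can
  be computed by substituting in every subexpression. A substitution is a ring homomorphism only on
  those rational functions that have a denominator which survives it, so its graph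
  \<open>has_subst\<close> is used as a relation that propagates through the field operations. The same
  relation shows that the denominators are nonzero rational functions: substituting suitable
  constants for some of the parameters would turn their vanishing into \<open>0 = 1\<close>.
\<close>


section \<open>Substitution as a partial homomorphism\<close>

text \<open>
  Having the value \<open>y\<close> under the substitution includes being defined under it. An equation
  \<open>rf_subst \<sigma> f = y\<close> does not record definedness, and without it the compatibility
  with the field operations cannot be derived.
\<close>

definition has_subst :: "(param \<Rightarrow> ratfun) \<Rightarrow> ratfun \<Rightarrow> ratfun \<Rightarrow> bool"
  where "has_subst \<sigma> f y \<longleftrightarrow>
    (\<exists>a b. f = Fract a b \<and> poly_subst \<sigma> b \<noteq> 0 \<and> y = poly_subst \<sigma> a / poly_subst \<sigma> b)"

lemma has_substI:
  "poly_subst \<sigma> b \<noteq> 0 \<Longrightarrow> has_subst \<sigma> (Fract a b) (poly_subst \<sigma> a / poly_subst \<sigma> b)"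
  unfolding has_subst_def by blast

lemma has_substE:
  assumes "has_subst \<sigma> f y"
  obtains a b where "f = Fract a b" and "b \<noteq> 0" and "poly_subst \<sigma> b \<noteq> 0"
    and "y = poly_subst \<sigma> a / poly_subst \<sigma> b"
  using assms unfolding has_subst_def by (metis poly_subst_0)

lemma rf_subst_eq: "has_subst \<sigma> f y \<Longrightarrow> rf_subst \<sigma> f = y"
  by (elim has_substE) (simp add: rf_subst_Fract)

lemma has_subst_unique: "has_subst \<sigma> f y \<Longrightarrow> has_subst \<sigma> f z \<Longrightarrow> y = z"
  using rf_subst_eq by blast

lemma has_subst_var: "\<sigma> v = y \<Longrightarrow> has_subst \<sigma> (rf_var v) y"
  using has_substI[of \<sigma> 1 "Poly_Mapping.single (Poly_Mapping.single v 1) 1"]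
  by (simp add: rf_var_def monom_subst_def)

lemma has_subst_0: "has_subst \<sigma> 0 0"
  using has_substI[of \<sigma> 1 0] by (simp flip: Zero_fract_def)

lemma has_subst_1: "has_subst \<sigma> 1 1"
  using has_substI[of \<sigma> 1 1] by (simp flip: One_fract_def)

lemma has_subst_mult:
  assumes "has_subst \<sigma> f y" and "has_subst \<sigma> g z"
  shows "has_subst \<sigma> (f * g) (y * z)"
  using assms
proof (elim has_substE)
  fix a b c d
  assume *: "f = Fract a b" "poly_subst \<sigma> b \<noteq> 0" "y = poly_subst \<sigma> a / poly_subst \<sigma> b"
    "g = Fract c d" "poly_subst \<sigma> d \<noteq> 0" "z = poly_subst \<sigma> c / poly_subst \<sigma> d"
  then show ?thesis
    using has_substI[of \<sigma> "b * d" "a * c"] by (simp add: poly_subst_mult)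
qed

lemma has_subst_diff:
  assumes "has_subst \<sigma> f y" and "has_subst \<sigma> g z"
  shows "has_subst \<sigma> (f - g) (y - z)"
  using assms
proof (elim has_substE)
  fix a b c d
  assume *: "f = Fract a b" "b \<noteq> 0" "poly_subst \<sigma> b \<noteq> 0" "y = poly_subst \<sigma> a / poly_subst \<sigma> b"
    "g = Fract c d" "d \<noteq> 0" "poly_subst \<sigma> d \<noteq> 0" "z = poly_subst \<sigma> c / poly_subst \<sigma> d"
  then show ?thesis
    using has_substI[of \<sigma> "b * d" "a * d - c * b"]
    by (simp add: poly_subst_mult poly_subst_diff diff_frac_eq)
qed

lemma has_subst_divide:
  assumes "has_subst \<sigma> f y" and "has_subst \<sigma> g z" and "z \<noteq> 0"
  shows "has_subst \<sigma> (f / g) (y / z)"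
  using assms(1,2)
proof (elim has_substE)
  fix a b c d
  assume *: "f = Fract a b" "poly_subst \<sigma> b \<noteq> 0" "y = poly_subst \<sigma> a / poly_subst \<sigma> b"
    "g = Fract c d" "poly_subst \<sigma> d \<noteq> 0" "z = poly_subst \<sigma> c / poly_subst \<sigma> d"
  moreover have "poly_subst \<sigma> c \<noteq> 0"
    using * \<open>z \<noteq> 0\<close> by auto
  ultimately show ?thesis
    using has_substI[of \<sigma> "b * c" "a * d"] by (simp add: poly_subst_mult)
qed

lemma has_subst_prod:
  assumes "\<And>j. j \<in> A \<Longrightarrow> has_subst \<sigma> (f j) (g j)"
  shows "has_subst \<sigma> (\<Prod>j\<in>A. f j) (\<Prod>j\<in>A. g j)"
  using assms
  by (induction A rule: infinite_finite_induct) (auto intro: has_subst_1 has_subst_mult)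

lemma has_subst_abelian_lhs:
  assumes P: "\<And>j. j \<in> {1..r} \<Longrightarrow> has_subst \<sigma> (P j) (P' j) \<and> P' j \<noteq> 0"
    and t: "\<And>a. a \<in> {1..n} \<Longrightarrow> has_subst \<sigma> (t a) (t' a) \<and> t' a \<noteq> 0"
    and Q: "has_subst \<sigma> (Q i) (Q' i)"
    and lam: "has_subst \<sigma> lam lam'"
    and hbar: "has_subst \<sigma> hbar hbar'"
    and i: "i \<in> {1..r}"
  shows "has_subst \<sigma> (abelian_lhs r n P Q t lam hbar i) (abelian_lhs r n P' Q' t' lam' hbar' i)"
  unfolding abelian_lhs_def
  using P[OF i] P t
  by (intro has_subst_diff has_subst_mult has_subst_prod has_subst_divide has_subst_1 Q lam hbar) auto


section \<open>Nonvanishing of the denominators\<close>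

lemma rf_var_nonzero: "rf_var v \<noteq> 0"
  using has_subst_unique[OF has_subst_var[of "\<lambda>_. 1" v, OF refl]] has_subst_0
  by (metis zero_neq_one)

lemma rf_var_inject: "rf_var u = rf_var v \<longleftrightarrow> u = v"
proof
  let ?\<sigma> = "\<lambda>w. if w = u then 0 else 1 :: ratfun"
  assume "rf_var u = rf_var v"
  then have "?\<sigma> u = ?\<sigma> v"
    using rf_subst_var[of ?\<sigma> u] rf_subst_var[of ?\<sigma> v] by simp
  then show "u = v"
    by (simp split: if_splits)
qed simp

text \<open>
  Setting the one parameter \<open>u\<close> to \<open>0\<close> and all others to \<open>1\<close> separates the two sides.
\<close>

lemma rf_var_mult_neq_rf_var:
  assumes "u \<noteq> w"
  shows "rf_var u * rf_var v \<noteq> rf_var w"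
proof
  let ?\<sigma> = "\<lambda>p. if p = u then 0 else 1"
  assume eq: "rf_var u * rf_var v = rf_var w"
  have "has_subst ?\<sigma> (rf_var u * rf_var v) (0 * ?\<sigma> v)"
    by (intro has_subst_mult has_subst_var) simp_all
  moreover have "has_subst ?\<sigma> (rf_var u * rf_var v) 1"
    unfolding eq using assms by (intro has_subst_var) simp
  ultimately show False
    using has_subst_unique by fastforce
qed


section \<open>Clearing the denominators of the Bethe-Ansatz equation\<close>

lemma clearing_factor_nonzero:
  fixes x t :: "nat \<Rightarrow> 'a::field"
  assumes "\<And>j. j \<in> {1..r} \<Longrightarrow> x j \<noteq> 0"
    and "\<And>a. a \<in> {1..n} \<Longrightarrow> hbar * (x i / t a) - 1 \<noteq> 0"
    and "\<And>j. j \<in> {1..r} - {i} \<Longrightarrow> hbar * x i - x j \<noteq> 0 \<and> x i - x j \<noteq> 0"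
    and "i \<in> {1..r}"
  shows "clearing_factor r n x t hbar i \<noteq> 0"
proof -
  have "1 - hbar * (x i / x j) \<noteq> 0" "1 - x j / x i \<noteq> 0" if "j \<in> {1..r} - {i}" for j
    using assms(1)[of i] assms(1)[of j] assms(3)[OF that] assms(4) that
    by (auto simp: field_simps)
  moreover have "1 - hbar * (x i / t a) \<noteq> 0" if "a \<in> {1..n}" for a
    using assms(2)[OF that] by auto
  ultimately show ?thesis
    unfolding clearing_factor_def by (simp only: mult_eq_0_iff prod_zero_iff finite_Diff finite_atLeastAtMost) blast
qed

text \<open>
  All cancellations take place factor by factor: \<open>T\<close> records those for the indices \<open>a\<close>, and \<open>R\<close>
  those for the indices \<open>j \<noteq> i\<close>, each of which contributes one sign.
\<close>

lemma abelian_lhs_eq_clearing_factor_times_bethe_lhs: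
  fixes x t :: "nat \<Rightarrow> 'a::field"
  assumes x: "\<And>j. j \<in> {1..r} \<Longrightarrow> x j \<noteq> 0"
    and t: "\<And>a. a \<in> {1..n} \<Longrightarrow> hbar * (x i / t a) - 1 \<noteq> 0"
    and d: "\<And>j. j \<in> {1..r} - {i} \<Longrightarrow> hbar * x i - x j \<noteq> 0"
    and i: "i \<in> {1..r}"
  shows "abelian_lhs r n x (\<lambda>_. Q) t 1 hbar i =
    clearing_factor r n x t hbar i * bethe_lhs r n x Q t hbar i"
proof -
  let ?J = "{1..r} - {i}"
  let ?A = "\<Prod>j\<in>?J. 1 - hbar * (x i / x j)" and ?B = "\<Prod>j\<in>?J. 1 - x j / x i"
  let ?A' = "\<Prod>j\<in>?J. 1 - hbar * (x j / x i)" and ?B' = "\<Prod>j\<in>?J. 1 - x i / x j"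
  let ?R = "\<Prod>j\<in>?J. (hbar * x j - x i) / (hbar * x i - x j)"
  let ?T = "\<Prod>a=1..n. 1 - x i / t a" and ?T' = "\<Prod>a=1..n. 1 - hbar * (x i / t a)"
  let ?S = "\<Prod>a=1..n. (x i / t a - 1) / (hbar * (x i / t a) - 1)"
  have T: "?T' * ?S = ?T"
    unfolding prod.distrib[symmetric]
  proof (rule prod.cong[OF refl])
    fix a assume "a \<in> {1..n}"
    have "(1 - hbar * q) * ((q - 1) / (hbar * q - 1)) = 1 - q" if "hbar * q - 1 \<noteq> 0" for q
      using that by (simp add: divide_simps) (simp add: algebra_simps)
    from this[OF t[OF \<open>a \<in> {1..n}\<close>]]
    show "(1 - hbar * (x i / t a)) * ((x i / t a - 1) / (hbar * (x i / t a) - 1)) = 1 - x i / t a" .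
  qed
  have "?A * ?B * ?R = (\<Prod>j\<in>?J. - 1 * ((1 - hbar * (x j / x i)) * (1 - x i / x j)))"
    unfolding prod.distrib[symmetric]
  proof (rule prod.cong[OF refl])
    fix j assume j: "j \<in> ?J"
    have nz: "x i \<noteq> 0" "x j \<noteq> 0" "hbar * x i - x j \<noteq> 0"
      using x i j d by auto
    have "(1 - hbar * (x i / x j)) * (1 - x j / x i) * ((hbar * x j - x i) / (hbar * x i - x j))
        = (1 - hbar * (x i / x j)) / (hbar * x i - x j) * ((1 - x j / x i) * (hbar * x j - x i))"
      by simp
    also have "(1 - hbar * (x i / x j)) / (hbar * x i - x j) = - 1 / x j"
      using nz by (simp add: divide_simps)
    also have "- 1 / x j * ((1 - x j / x i) * (hbar * x j - x i))
        = - 1 * ((1 - hbar * (x j / x i)) * (1 - x i / x j))"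
      using nz by (simp add: field_simps)
    finally show "(1 - hbar * (x i / x j)) * (1 - x j / x i) *
        ((hbar * x j - x i) / (hbar * x i - x j)) =
        - 1 * ((1 - hbar * (x j / x i)) * (1 - x i / x j))" .
  qed
  also have "\<dots> = (- 1) ^ (r - 1) * (?A' * ?B')"
    using i by (simp only: prod.distrib prod_constant) simp
  finally have R: "?A * ?B * ?R = (- 1) ^ (r - 1) * (?A' * ?B')" .
  have sign: "(- 1) ^ r * (- 1) ^ (r - 1) = (- 1 :: 'a)"
    using i by (cases r) (auto simp flip: power_add simp: mult_2[symmetric])
  have "clearing_factor r n x t hbar i * bethe_lhs r n x Q t hbar i
      = ?A * ?B * (?T' * ?S) + (- 1) ^ r * Q * ?T' * (?A * ?B * ?R)"
    unfolding clearing_factor_def bethe_lhs_def by (simp add: algebra_simps)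
  also have "\<dots> = ?A * ?B * ?T + ((- 1) ^ r * (- 1) ^ (r - 1)) * (Q * ?A' * ?T' * ?B')"
    unfolding T R by (simp add: mult_ac)
  also have "\<dots> = abelian_lhs r n x (\<lambda>_. Q) t 1 hbar i"
    unfolding sign abelian_lhs_def by simp
  finally show ?thesis ..
qed


section \<open>The image of the abelian equations\<close>

theorem proposition3p5:
  fixes r n :: nat
  assumes "1 \<le> r" and "r \<le> n"
  shows
    "(\<forall>i\<in>{1..r}.
        clearing_factor r n (\<lambda>j. rf_var (Var_x j)) (\<lambda>a. rf_var (Var_t a)) (rf_var Var_hbar) i \<noteq> 0 \<and>
        change_vars (phi (abelian_lhs r n (\<lambda>j. rf_var (Var_P j)) (\<lambda>j. rf_var (Var_Qi j))
            (\<lambda>a. rf_var (Var_t a)) (rf_var Var_lambda) (rf_var Var_hbar) i)) =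
          clearing_factor r n (\<lambda>j. rf_var (Var_x j)) (\<lambda>a. rf_var (Var_t a)) (rf_var Var_hbar) i
          * bethe_lhs r n (\<lambda>j. rf_var (Var_x j)) (rf_var Var_Q)
              (\<lambda>a. rf_var (Var_t a)) (rf_var Var_hbar) i)
     \<and>
     (\<forall>(x :: nat \<Rightarrow> 'a::field) t hbar Q.
        (\<forall>i\<in>{1..r}. x i \<noteq> 0) \<longrightarrow>
        (\<forall>a\<in>{1..n}. t a \<noteq> 0) \<longrightarrow>
        (\<forall>i\<in>{1..r}. \<forall>a\<in>{1..n}. hbar * (x i / t a) - 1 \<noteq> 0) \<longrightarrow>
        (\<forall>i\<in>{1..r}. \<forall>j\<in>{1..r} - {i}. hbar * x i - x j \<noteq> 0 \<and> x i - x j \<noteq> 0) \<longrightarrow>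
        (\<forall>i\<in>{1..r}. abelian_lhs r n x (\<lambda>_. Q) t 1 hbar i = 0 \<longleftrightarrow> bethe_lhs r n x Q t hbar i = 0))"
proof (intro conjI ballI allI impI)
  fix i assume i: "i \<in> {1..r}"
  let ?x = "\<lambda>j. rf_var (Var_x j)" and ?P = "\<lambda>j. rf_var (Var_P j)"
    and ?t = "\<lambda>a. rf_var (Var_t a)" and ?h = "rf_var Var_hbar" and ?Q = "rf_var Var_Q"
  have x: "?x j \<noteq> 0" and t: "?h * (?x i / ?t j) - 1 \<noteq> 0" for j
    using rf_var_mult_neq_rf_var[of Var_hbar "Var_t j" "Var_x i"]
    by (simp_all add: rf_var_nonzero)
  have d: "?h * ?x i - ?x j \<noteq> 0 \<and> ?x i - ?x j \<noteq> 0" if "j \<in> {1..r} - {i}" for j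
    using that rf_var_mult_neq_rf_var[of Var_hbar "Var_x j" "Var_x i"]
    by (auto simp: rf_var_inject)
  show "clearing_factor r n ?x ?t ?h i \<noteq> 0"
    using clearing_factor_nonzero[of r ?x n ?h i ?t] x t d i by blast
  have "phi (abelian_lhs r n ?P (\<lambda>j. rf_var (Var_Qi j)) ?t (rf_var Var_lambda) ?h i)
      = abelian_lhs r n ?P (\<lambda>_. ?Q) ?t 1 ?h i"
    unfolding phi_def using i
    by (intro rf_subst_eq has_subst_abelian_lhs conjI has_subst_var)
      (simp_all add: rf_var_nonzero)
  moreover have "change_vars (abelian_lhs r n ?P (\<lambda>_. ?Q) ?t 1 ?h i)
      = abelian_lhs r n ?x (\<lambda>_. ?Q) ?t 1 ?h i"
    unfolding change_vars_def using i
    by (intro rf_subst_eq has_subst_abelian_lhs conjI has_subst_var has_subst_1)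
      (simp_all add: rf_var_nonzero)
  ultimately show "change_vars (phi (abelian_lhs r n ?P (\<lambda>j. rf_var (Var_Qi j)) ?t
        (rf_var Var_lambda) ?h i)) =
      clearing_factor r n ?x ?t ?h i * bethe_lhs r n ?x ?Q ?t ?h i"
    using abelian_lhs_eq_clearing_factor_times_bethe_lhs[of r ?x n ?h i ?t ?Q] x t d i by simp
next
  fix x t :: "nat \<Rightarrow> 'a" and hbar Q :: 'a and i
  assume x: "\<forall>i\<in>{1..r}. x i \<noteq> 0"
    and t: "\<forall>i\<in>{1..r}. \<forall>a\<in>{1..n}. hbar * (x i / t a) - 1 \<noteq> 0"
    and d: "\<forall>i\<in>{1..r}. \<forall>j\<in>{1..r} - {i}. hbar * x i - x j \<noteq> 0 \<and> x i - x j \<noteq> 0"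
    and i: "i \<in> {1..r}"
  have "clearing_factor r n x t hbar i \<noteq> 0"
    by (rule clearing_factor_nonzero) (use x t d i in blast)+
  moreover have "abelian_lhs r n x (\<lambda>_. Q) t 1 hbar i =
      clearing_factor r n x t hbar i * bethe_lhs r n x Q t hbar i"
    by (rule abelian_lhs_eq_clearing_factor_times_bethe_lhs) (use x t d i in blast)+
  ultimately show "abelian_lhs r n x (\<lambda>_. Q) t 1 hbar i = 0 \<longleftrightarrow> bethe_lhs r n x Q t hbar i = 0"
    by simp
qed

end
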